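(* Let $B$ be a finite Blaschke product and $\Theta\in\mathfrak I_c$. Then $B\circ\Theta\in\mathfrak I_c$.
   Context: $\mathbb D$ is the open unit disk. A finite Blaschke product is a function $B(z)=e^{i\theta}\prod_{j=1}^N\frac{a_j-z}{1-\overline{a_j}z}$ with $N\ge 1$, $\theta\in\mathbb R$, $a_j\in\mathbb D$. $\mathfrak I_c$ denotes the set of one-component inner functions: inner functions $u$ on $\mathbb D$ for which there is $\eta\in\,]0,1[$ such that $\Omega_u(\eta)=\{z\in\mathbb D:|u(z)|<\eta\}$ is connected. *)

theory Defs
  imports "HOL-Complex_Analysis.Complex_Analysis"
begin

text \<open>
  Functions on the unit disk are represented by total functions on the complex plane, of which
  only the values on \<^term>\<open>ball 0 1 :: complex set\<close> matter.
\<close>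

definition has_radial_limit :: "(complex \<Rightarrow> complex) \<Rightarrow> real \<Rightarrow> complex \<Rightarrow> bool" where
  "has_radial_limit u t l \<longleftrightarrow> ((\<lambda>r. u (of_real r * cis t)) \<longlongrightarrow> l) (at_left 1)"

text \<open>
  Unimodular constants are inner functions in this sense, as usual.
\<close>
definition inner_function :: "(complex \<Rightarrow> complex) \<Rightarrow> bool" where
  "inner_function u \<longleftrightarrow>
     u holomorphic_on ball 0 1 \<and>
     (\<forall>z\<in>ball 0 1. norm (u z) \<le> 1) \<and>
     (AE t in lebesgue_on {0..2 * pi}. \<exists>l. has_radial_limit u t l \<and> norm l = 1)"

definition sublevel_set :: "(complex \<Rightarrow> complex) \<Rightarrow> real \<Rightarrow> complex set" where
  "sublevel_set u \<eta> = {z \<in> ball 0 1. norm (u z) < \<eta>}"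

text \<open>
  The empty set counts as connected, so unimodular constants are one-component inner functions.
\<close>
definition one_component_inner :: "(complex \<Rightarrow> complex) set" where
  "one_component_inner =
     {u. inner_function u \<and> (\<exists>\<eta>\<in>{0<..<1}. connected (sublevel_set u \<eta>))}"

text \<open>
  A finite Blaschke product is given by its formula on the whole closed disk, where the
  denominators do not vanish; boundary values are needed to compose it with a unimodular constant.
\<close>
definition finite_Blaschke_product :: "(complex \<Rightarrow> complex) \<Rightarrow> bool" where
  "finite_Blaschke_product B \<longleftrightarrow>
     (\<exists>(\<theta>::real) (N::nat) (a :: nat \<Rightarrow> complex).
        N \<ge> 1 \<and> (\<forall>j\<in>{1..N}. a j \<in> ball 0 1) \<and>
        (\<forall>z\<in>cball 0 1. B z = exp (\<i> * of_real \<theta>) * (\<Prod>j=1..N. (a j - z) / (1 - cnj (a j) * z))))"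

end

theory Submission
  imports Defs
begin

text \<open>
  Write \<open>\<Omega>\<^sub>u(\<eta>)\<close> for the sublevel set \<open>{|u| < \<eta>}\<close> in the disk. The theorem rests on one principle: for
  an inner function \<open>u\<close> and \<open>\<eta> < 1\<close>, the infimum of \<open>|u|\<close> over every connected component \<open>C\<close> of
  \<open>\<Omega>\<^sub>u(\<eta>)\<close> is zero (\<open>component_of_sublevel_set_meets_lower_sublevel_set\<close>). Indeed, were \<open>|u|\<close>
  bounded below on \<open>C\<close>, then \<open>log (\<eta> / |u|)\<close> would be a bounded positive harmonic function on \<open>C\<close>
  that vanishes on the part of the boundary inside the disk; the rest of the boundary lies on the
  unit circle, where the radial limits of \<open>u\<close> are unimodular almost everywhere, so that it should
  not count for a bounded harmonic function.

  To make the last point precise without harmonic measure, \<open>C\<close> is cut off at a circle of radius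
  \<open>r\<close> close to 1. The angles at which \<open>|u|\<close> is still at most \<open>\<eta>\<close> on that circle form a compact set
  of small measure, since for almost every angle this happens only for finitely many radii of a
  given sequence tending to 1. Finitely many arcs of small total length cover it, and a sum of
  Poisson kernels with poles just outside these arcs is a positive harmonic function that is at
  least 1 on the arcs and small at any prescribed point. A multiple of it dominates
  \<open>log (\<eta> / |u|)\<close> on the boundary, hence also at the prescribed point, by the maximum principle;
  this is absurd once the arcs are short enough.

  As a consequence (\<open>connected_sublevel_setI\<close>), \<open>\<Omega>\<^sub>u(\<eta>)\<close> is connected as soon as some connected set
  \<open>S\<close> fits in between: \<open>\<Omega>\<^sub>u(\<sigma>) \<subseteq> S \<subseteq> \<Omega>\<^sub>u(\<eta>)\<close> with \<open>\<sigma> > 0\<close>, because every component meets \<open>S\<close>. For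
  \<open>u = \<Theta>\<close> this shows that \<open>\<Omega>\<^sub>\<Theta>(\<eta>')\<close> stays connected when \<open>\<eta>'\<close> increases, so that one may choose
  \<open>\<eta>'\<close> larger than the moduli of all zeros of \<open>B\<close>. Now \<open>|B|\<close> is bounded below by some \<open>\<sigma> > 0\<close> on
  \<open>{\<eta>' \<le> |w| \<le> 1}\<close> and bounded above by some number less than 1 on \<open>{|w| \<le> \<eta>'}\<close>. Hence
  \<open>S = \<Omega>\<^sub>\<Theta>(\<eta>')\<close> fits in between two sublevel sets of the inner function \<open>B \<circ> \<Theta>\<close>.
\<close>

section \<open>Exceptional arcs on circles\<close>

text \<open>
  Arcs of a uniform grid are used because distinct grid intervals are disjoint: if the mesh is
  smaller than the distance from \<open>K\<close> to the complement of an open neighbourhood \<open>U\<close> of \<open>K\<close>, the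
  intervals meeting \<open>K\<close> lie in \<open>U\<close>, so that their total length is at most the measure of \<open>U\<close>.
\<close>

lemma compact_small_measure_grid_cover:
  fixes K :: "real set"
  assumes K: "compact K" "measure lebesgue K < \<epsilon>"
  obtains \<delta> I where "0 < \<delta>" "\<delta> \<le> (1::real)" "finite (I :: nat set)" "real (card I) * \<delta> < \<epsilon>"
    "\<And>t. t \<in> K \<Longrightarrow> 0 \<le> t \<Longrightarrow> \<exists>k\<in>I. \<bar>t - real k * \<delta>\<bar> \<le> \<delta>"
proof -
  have Kl: "K \<in> lmeasurable" using K(1) by (rule lmeasurable_compact)
  obtain U where U: "open U" "K \<subseteq> U" "U - K \<in> lmeasurable"
      "emeasure lebesgue (U - K) < ennreal (\<epsilon> - measure lebesgue K)"
    using sets_lebesgue_outer_open[of K "\<epsilon> - measure lebesgue K"] Kl K(2) by auto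
  have UK: "U = K \<union> (U - K)" using U(2) by auto
  have Ul: "U \<in> lmeasurable" using fmeasurable.Un[OF Kl U(3)] UK by simp
  have "measure lebesgue (U - K) < \<epsilon> - measure lebesgue K"
    using U(3,4) K(2) by (simp add: emeasure_eq_measure2 ennreal_less_iff)
  then have mU: "measure lebesgue U < \<epsilon>"
    using measure_Un_le[of K lebesgue "U - K"] Kl U(3) UK by (simp add: fmeasurableD)
  obtain e where e: "e > 0" "(\<Union>x\<in>K. ball x e) \<subseteq> U"
    using compact_subset_open_imp_ball_epsilon_subset[OF K(1) U(1) U(2)] by blast
  define \<delta> where "\<delta> = min 1 (e/2)"
  have \<delta>: "0 < \<delta>" "\<delta> \<le> 1" "\<delta> < e" using e by (auto simp: \<delta>_def)
  define J where "J = (\<lambda>k::nat. {real k * \<delta> ..< real (Suc k) * \<delta>})"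
  define I where "I = {k. J k \<inter> K \<noteq> {}}"
  have floor: "k = nat \<lfloor>t/\<delta>\<rfloor>" if "t \<in> J k" for t k
  proof -
    have "\<lfloor>t/\<delta>\<rfloor> = int k" using that \<delta> by (intro floor_unique) (auto simp: J_def field_simps)
    then show ?thesis by simp
  qed
  obtain b where b: "\<And>t. t \<in> K \<Longrightarrow> t \<le> b"
    using bounded_imp_bdd_above[OF compact_imp_bounded[OF K(1)]] by (auto simp: bdd_above_def)
  have "I \<subseteq> {..nat \<lceil>b/\<delta>\<rceil>}"
  proof
    fix k assume "k \<in> I"
    then obtain t where "t \<in> J k" "t \<le> b" using b by (auto simp: I_def)
    then have "real k * \<delta> \<le> b" by (auto simp: J_def)
    then have "real k \<le> b/\<delta>" using \<delta> by (simp add: field_simps)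
    then show "k \<in> {..nat \<lceil>b/\<delta>\<rceil>}" by simp linarith
  qed
  then have fin: "finite I" by (rule finite_subset) simp
  have disj: "disjoint_family_on J I"
    unfolding disjoint_family_on_def using floor by blast
  have JU: "(\<Union>k\<in>I. J k) \<subseteq> U"
  proof
    fix s assume "s \<in> (\<Union>k\<in>I. J k)"
    then obtain k t where "s \<in> J k" "t \<in> J k" "t \<in> K" by (auto simp: I_def)
    then have "dist t s < e" using \<delta> by (auto simp: J_def dist_real_def algebra_simps)
    then have "s \<in> (\<Union>x\<in>K. ball x e)" using \<open>t \<in> K\<close> by auto
    then show "s \<in> U" using e(2) by blast
  qed
  have Jm: "J k \<in> lmeasurable" "measure lebesgue (J k) = \<delta>" for k
  proof -
    show "J k \<in> lmeasurable"
      by (rule bounded_set_imp_lmeasurable) (auto simp: J_def)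
    show "measure lebesgue (J k) = \<delta>" using \<delta> by (simp add: J_def algebra_simps)
  qed
  have "real (card I) * \<delta> = measure lebesgue (\<Union>k\<in>I. J k)"
    using measure_UNION'[OF fin, of J lebesgue] disj Jm
    by (simp add: disjoint_family_on_def pairwise_def disjnt_def)
  also have "\<dots> \<le> measure lebesgue U"
    using JU Ul Jm fin by (intro measure_mono_fmeasurable) (auto intro!: sets.finite_UN fmeasurableD)
  finally have card: "real (card I) * \<delta> < \<epsilon>" using mU by simp
  show thesis
  proof (rule that[OF \<delta>(1,2) fin card])
    fix t assume t: "t \<in> K" "0 \<le> t"
    define k where "k = nat \<lfloor>t/\<delta>\<rfloor>"
    have "real k \<le> t/\<delta>" "t/\<delta> < real k + 1" using t \<delta> by (auto simp: k_def)
    then have "t \<in> J k" using \<delta> by (auto simp: J_def field_simps)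
    then have "k \<in> I" "\<bar>t - real k * \<delta>\<bar> \<le> \<delta>" using t by (auto simp: I_def J_def algebra_simps)
    then show "\<exists>k\<in>I. \<bar>t - real k * \<delta>\<bar> \<le> \<delta>" by blast
  qed
qed

text \<open>
  Almost every \<open>t\<close> has a radial limit of modulus \<open>1 > \<eta>\<close>, hence lies in the exceptional sets of only
  finitely many radii of a sequence tending to 1; dominated convergence for the indicator functions
  makes the measures tend to 0.
\<close>
lemma inner_function_small_level_on_circle:
  assumes f: "inner_function f" and "\<eta> < 1" "0 < \<epsilon>" "\<rho> < 1"
  obtains r where "\<rho> < r" "0 < r" "r < 1"
    "compact {t\<in>{0..2*pi}. norm (f (of_real r * cis t)) \<le> \<eta>}"
    "measure lebesgue {t\<in>{0..2*pi}. norm (f (of_real r * cis t)) \<le> \<eta>} < \<epsilon>"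
proof -
  define r where "r = (\<lambda>n. 1 - inverse (real (n+2)))"
  have r: "0 < r n" "r n < 1" for n by (auto simp: r_def field_simps)
  have rlim: "r \<longlonglongrightarrow> 1" unfolding r_def by real_asymp
  have rleft: "filterlim r (at_left 1) sequentially"
    using rlim r by (auto simp: filterlim_at less_imp_neq intro!: always_eventually)
  define K where "K = (\<lambda>n. {t\<in>{0..2*pi}. norm (f (of_real (r n) * cis t)) \<le> \<eta>})"
  have cf: "continuous_on (ball 0 1) f"
    using f by (auto simp: inner_function_def intro: holomorphic_on_imp_continuous_on)
  have Kc: "compact (K n)" for n
  proof -
    have "continuous_on {0..2*pi} (\<lambda>t. norm (f (of_real (r n) * cis t)))"
      using r[of n] by (intro continuous_intros continuous_on_compose2[OF cf]) (auto simp: norm_mult)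
    then have "closed ({0..2*pi} \<inter> (\<lambda>t. norm (f (of_real (r n) * cis t))) -` {..\<eta>})"
      by (intro continuous_closed_preimage) auto
    moreover have "{0..2*pi} \<inter> (\<lambda>t. norm (f (of_real (r n) * cis t))) -` {..\<eta>} = K n"
      by (auto simp: K_def)
    ultimately have "closed (K n)" by simp
    moreover have "bounded (K n)" by (rule bounded_subset[of "{0..2*pi}"]) (auto simp: K_def)
    ultimately show ?thesis by (simp add: compact_eq_bounded_closed)
  qed
  have AE: "AE t in lebesgue_on {0..2*pi}. \<exists>l. has_radial_limit f t l \<and> norm l = 1"
    using f by (simp add: inner_function_def)
  have lim: "(\<lambda>n. indicat_real (K n) t) \<longlonglongrightarrow> 0" if "has_radial_limit f t l" "norm l = 1" for t l
  proof -
    have "(\<lambda>n. norm (f (of_real (r n) * cis t))) \<longlonglongrightarrow> norm l"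
      using filterlim_compose[OF that(1)[unfolded has_radial_limit_def] rleft]
      by (rule tendsto_norm)
    then have "\<forall>\<^sub>F n in sequentially. norm (f (of_real (r n) * cis t)) > \<eta>"
      using assms(2) that(2) by (intro order_tendstoD) auto
    then have "\<forall>\<^sub>F n in sequentially. indicat_real (K n) t = 0"
      by (rule eventually_mono) (auto simp: K_def indicator_def)
    then show ?thesis by (rule tendsto_eventually)
  qed
  have Kl: "K n \<in> sets lebesgue" for n using Kc lmeasurable_compact by blast
  have Ks: "K n \<in> sets (lebesgue_on {0..2*pi})" for n
    using Kl[of n] by (subst sets_restrict_space_iff) (auto simp: K_def)
  have "(\<lambda>n. integral\<^sup>L (lebesgue_on {0..2*pi}) (indicat_real (K n))) \<longlonglongrightarrow>
        integral\<^sup>L (lebesgue_on {0..2*pi}) (\<lambda>t. 0)"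
  proof (rule integral_dominated_convergence[where w = "\<lambda>_. 1"])
    show "AE t in lebesgue_on {0..2*pi}. (\<lambda>n. indicat_real (K n) t) \<longlonglongrightarrow> 0"
      using AE by eventually_elim (use lim in blast)
    show "indicat_real (K n) \<in> borel_measurable (lebesgue_on {0..2*pi})" for n
      using Ks by (rule borel_measurable_indicator)
    show "AE t in lebesgue_on {0..2*pi}. norm (indicat_real (K n) t) \<le> 1" for n
      by (intro AE_I2) (simp add: indicator_def)
  qed auto
  moreover have "integral\<^sup>L (lebesgue_on {0..2*pi}) (indicat_real (K n)) = measure lebesgue (K n)" for n
  proof -
    have sub: "K n \<subseteq> {0..2*pi}" by (auto simp: K_def)
    then have "measure (lebesgue_on {0..2*pi}) (K n) = measure lebesgue (K n)"
      by (intro measure_restrict_space) auto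
    then show ?thesis using sub by (simp add: Int_absorb2)
  qed
  ultimately have "(\<lambda>n. measure lebesgue (K n)) \<longlonglongrightarrow> 0" by simp
  then have "\<forall>\<^sub>F n in sequentially. measure lebesgue (K n) < \<epsilon>"
    using assms(3) by (intro order_tendstoD)
  moreover have "\<forall>\<^sub>F n in sequentially. \<rho> < r n" using rlim assms(4) by (intro order_tendstoD)
  ultimately have "\<forall>\<^sub>F n in sequentially. measure lebesgue (K n) < \<epsilon> \<and> \<rho> < r n"
    by eventually_elim auto
  then obtain n where "measure lebesgue (K n) < \<epsilon>" "\<rho> < r n"
    by (auto simp: eventually_sequentially)
  then show thesis using r[of n] Kc[of n] unfolding K_def by (intro that[of "r n"])
qed

section \<open>A positive harmonic function dominating short arcs\<close>

lemma Re_Schwarz_kernel: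
  fixes p z :: complex
  shows "Re ((p + z) / (p - z)) = ((norm p)\<^sup>2 - (norm z)\<^sup>2) / (norm (p - z))\<^sup>2"
proof -
  have "Re ((p + z) * cnj (p - z)) = (norm p)\<^sup>2 - (norm z)\<^sup>2"
    by (simp only: cmod_power2) (simp add: power2_eq_square algebra_simps)
  moreover have "(p + z) / (p - z) = (p + z) * cnj (p - z) / of_real ((norm (p - z))\<^sup>2)"
    by (rule complex_div_cnj)
  ultimately show ?thesis by (simp only: Re_divide_of_real)
qed

lemma norm_cis_diff_le: "norm (cis s - cis t) \<le> \<bar>s - t\<bar>"
proof -
  have "cis s - cis t = cis t * (exp (\<i> * of_real (s - t)) - 1)"
    unfolding cis_conv_exp[symmetric] by (simp add: right_diff_distrib cis_mult)
  then have "norm (cis s - cis t) = 2 * \<bar>sin ((s - t)/2)\<bar>"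
    by (simp only: norm_mult norm_cis dist_exp_i_1)
  also have "\<dots> \<le> \<bar>s - t\<bar>" using abs_sin_le_one abs_sin_x_le_abs_x[of "(s-t)/2"] by simp
  finally show ?thesis .
qed


text \<open>
  The real part of the Schwarz kernel with pole \<open>p\<close> is the Poisson kernel
  \<open>(|p|\<^sup>2 - |z|\<^sup>2) / |p - z|\<^sup>2\<close>. With the pole at relative distance \<open>\<delta>\<close> outside the circle of radius
  \<open>r\<close>, the numerator is at least \<open>2 \<delta> r\<^sup>2\<close> on the circle and the denominator at most \<open>4 \<delta>\<^sup>2 r\<^sup>2\<close> on the
  arc of half-length \<open>\<delta>\<close> facing the pole; so \<open>2 \<delta>\<close> times the kernel is at least 1 on that arc, while
  at a fixed interior point it is only of order \<open>\<delta>\<close>. Summing over the arcs gives a function that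
  is small inside when the arcs have small total length.
\<close>
lemma small_potential_of_short_arcs:
  fixes I :: "nat set"
  assumes r: "0 < r" and \<delta>: "0 < \<delta>" "\<delta> \<le> 1" and I: "finite I"
  obtains H where "H holomorphic_on ball 0 ((1 + \<delta>) * r)"
    "\<And>z. norm z \<le> r \<Longrightarrow> 0 \<le> Re (H z)"
    "\<And>t k. k \<in> I \<Longrightarrow> \<bar>t - real k * \<delta>\<bar> \<le> \<delta> \<Longrightarrow> 1 \<le> Re (H (of_real r * cis t))"
    "\<And>z. norm z < r \<Longrightarrow> Re (H z) \<le> 6 * r * (real (card I) * \<delta>) / (r - norm z)"
proof -
  define p where "p = (\<lambda>k::nat. of_real ((1 + \<delta>) * r) * cis (real k * \<delta>))"
  define S where "S = (\<lambda>k z. (p k + z) / (p k - z))"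
  define H where "H = (\<lambda>z. \<Sum>k\<in>I. of_real (2 * \<delta>) * S k z)"
  have np: "norm (p k) = (1 + \<delta>) * r" for k
    using r \<delta> unfolding p_def norm_mult norm_of_real norm_cis by simp
  have rp: "r < (1 + \<delta>) * r" using r \<delta> by (simp add: algebra_simps)
  have hol: "H holomorphic_on ball 0 ((1 + \<delta>) * r)"
    unfolding H_def S_def using np by (intro holomorphic_intros) auto
  have Re_H: "Re (H z) = (\<Sum>k\<in>I. 2 * \<delta> * Re (S k z))" for z
  proof -
    have "Re (of_real c * w) = c * Re w" for c w by simp
    then show ?thesis by (simp only: H_def Re_sum)
  qed
  have S_nonneg: "0 \<le> Re (S k z)" if "norm z \<le> r" for k z
    unfolding S_def Re_Schwarz_kernel np
    using power_mono[of "norm z" "(1 + \<delta>) * r" 2] that rp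
    by (intro divide_nonneg_nonneg) auto
  have nonneg: "0 \<le> Re (H z)" if "norm z \<le> r" for z
    unfolding Re_H using S_nonneg[OF that] \<delta> by (intro sum_nonneg) simp
  have ge1: "1 \<le> Re (H (of_real r * cis t))" if k: "k \<in> I" and t: "\<bar>t - real k * \<delta>\<bar> \<le> \<delta>" for t k
  proof -
    define z where "z = of_real r * cis t"
    have nz: "norm z = r" using r by (simp add: z_def norm_mult)
    have "p k - z = of_real (\<delta> * r) * cis (real k * \<delta>) + of_real r * (cis (real k * \<delta>) - cis t)"
      by (simp add: p_def z_def algebra_simps)
    then have "norm (p k - z) \<le> \<delta> * r + r * norm (cis (real k * \<delta>) - cis t)"
      using r \<delta> norm_triangle_ineq[of "of_real (\<delta> * r) * cis (real k * \<delta>)"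
          "of_real r * (cis (real k * \<delta>) - cis t)"]
      by (simp add: norm_mult)
    also have "norm (cis (real k * \<delta>) - cis t) \<le> \<delta>"
      using norm_cis_diff_le[of "real k * \<delta>" t] t by linarith
    finally have d: "norm (p k - z) \<le> 2 * \<delta> * r" using r by (simp add: algebra_simps)
    have d0: "0 < norm (p k - z)"
      using norm_triangle_ineq2[of "p k" z] np[of k] nz rp by linarith
    have "(norm (p k - z))\<^sup>2 \<le> (2 * \<delta> * r)\<^sup>2" using d by (intro power_mono) auto
    also have "\<dots> \<le> 2 * \<delta> * (((1 + \<delta>) * r)\<^sup>2 - r\<^sup>2)"
      using \<delta> by (simp add: power2_eq_square algebra_simps)
    finally have "1 \<le> 2 * \<delta> * (((1 + \<delta>) * r)\<^sup>2 - r\<^sup>2) / (norm (p k - z))\<^sup>2"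
      using d0 by simp
    then have "1 \<le> 2 * \<delta> * Re (S k z)"
      unfolding S_def Re_Schwarz_kernel np nz by simp
    also have "\<dots> \<le> (\<Sum>j\<in>I. 2 * \<delta> * Re (S j z))"
      using I k S_nonneg nz \<delta> by (intro member_le_sum) auto
    finally show ?thesis by (simp add: Re_H z_def)
  qed
  have upper: "Re (H z) \<le> 6 * r * (real (card I) * \<delta>) / (r - norm z)" if z: "norm z < r" for z
  proof -
    have "2 * \<delta> * Re (S k z) \<le> 6 * r * \<delta> / (r - norm z)" for k
    proof -
      have den: "r - norm z \<le> norm (p k - z)"
        using norm_triangle_ineq2[of "p k" z] np[of k] rp by linarith
      have "Re (S k z) \<le> norm (S k z)" by (rule complex_Re_le_cmod)
      also have "\<dots> = norm (p k + z) / norm (p k - z)" by (simp add: S_def norm_divide)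
      also have "\<dots> \<le> (3 * r) / (r - norm z)"
      proof (rule frac_le)
        have "\<delta> * r \<le> r" using \<delta> r by simp
        then show "norm (p k + z) \<le> 3 * r"
          using norm_triangle_ineq[of "p k" z] np[of k] z by (simp add: algebra_simps)
      qed (use den z r in auto)
      finally have "2 * \<delta> * Re (S k z) \<le> 2 * \<delta> * (3 * r / (r - norm z))"
        using \<delta> by (intro mult_left_mono) auto
      then show ?thesis by (simp add: mult_ac)
    qed
    then have "Re (H z) \<le> (\<Sum>k\<in>I. 6 * r * \<delta> / (r - norm z))"
      unfolding Re_H by (intro sum_mono)
    then show ?thesis by (simp add: algebra_simps)
  qed
  show thesis using that hol nonneg ge1 upper by blast
qed

section \<open>Components of sublevel sets of inner functions\<close>

lemma open_sublevel_set:
  assumes "inner_function f" shows "open (sublevel_set f \<eta>)"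
proof -
  have "continuous_on (ball 0 1) (\<lambda>z. norm (f z))"
    using assms by (auto simp: inner_function_def intro!: continuous_intros holomorphic_on_imp_continuous_on)
  then have "open (ball 0 1 \<inter> (\<lambda>z. norm (f z)) -` {..<\<eta>})"
    by (intro continuous_open_preimage) auto
  moreover have "ball 0 1 \<inter> (\<lambda>z. norm (f z)) -` {..<\<eta>} = sublevel_set f \<eta>"
    by (auto simp: sublevel_set_def)
  ultimately show ?thesis by simp
qed

text \<open>
  The maximum principle for \<open>log (\<eta> / |f|) - M Re H\<close>, with \<open>H\<close> the potential of the exceptional arcs
  and \<open>M = log (\<eta> / \<sigma>)\<close> an upper bound of \<open>log (\<eta> / |f|)\<close> on \<open>C\<close>, is applied in the form of the
  maximum modulus principle for \<open>F = \<eta> / f * exp (- M H)\<close>. This is holomorphic on \<open>C\<close> because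
  \<open>|f| \<ge> \<sigma>\<close> there.
\<close>
lemma component_of_sublevel_set_meets_lower_sublevel_set:
  assumes f: "inner_function f" and "\<eta> < 1" "0 < \<sigma>"
    and C: "C \<in> components (sublevel_set f \<eta>)"
  shows "C \<inter> sublevel_set f \<sigma> \<noteq> {}"
proof
  assume "C \<inter> sublevel_set f \<sigma> = {}"
  have Csub: "C \<subseteq> sublevel_set f \<eta>" using C by (rule in_components_subset)
  then have Cb: "C \<subseteq> ball 0 1" and Clt: "\<And>z. z \<in> C \<Longrightarrow> norm (f z) < \<eta>"
    by (auto simp: sublevel_set_def)
  have Cge: "\<sigma> \<le> norm (f z)" if "z \<in> C" for z
    using that \<open>C \<inter> sublevel_set f \<sigma> = {}\<close> Cb by (fastforce simp: sublevel_set_def)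
  obtain z0 where z0: "z0 \<in> C" using in_components_nonempty[OF C] by blast
  have z0b: "norm z0 < 1" using z0 Cb by auto
  have f0: "0 < norm (f z0)" "norm (f z0) < \<eta>" using Cge[OF z0] Clt[OF z0] assms(3) by auto
  have \<sigma>\<eta>: "\<sigma> < \<eta>" "0 < \<eta>" using Cge[OF z0] Clt[OF z0] assms(3) by auto
  have Copen: "open C" using open_components[OF open_sublevel_set[OF f] C] .
  have holf: "f holomorphic_on ball 0 1" using f by (simp add: inner_function_def)
  have contf: "continuous_on (ball 0 1) f" using holf by (rule holomorphic_on_imp_continuous_on)
  have clC: "\<sigma> \<le> norm (f z)" if "z \<in> closure C" "norm z < 1" for z
  proof (rule ccontr)
    assume "\<not> \<sigma> \<le> norm (f z)"
    then have "z \<in> sublevel_set f \<sigma>" using that by (auto simp: sublevel_set_def)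
    then show False
      using open_sublevel_set[OF f] that(1) \<open>C \<inter> sublevel_set f \<sigma> = {}\<close>
      by (metis disjoint_iff open_Int_closure_eq_empty)
  qed
  have bdC: "\<eta> \<le> norm (f z)" if "z \<in> closure C" "norm z < 1" "z \<notin> C" for z
  proof (rule ccontr)
    assume "\<not> \<eta> \<le> norm (f z)"
    then have "z \<in> sublevel_set f \<eta>" using that by (auto simp: sublevel_set_def)
    moreover have "closedin (top_of_set (sublevel_set f \<eta>)) C" using C by (rule closedin_component)
    ultimately show False
      using that by (metis IntI closedin_closed closure_minimal inf.cobounded2 subsetD IntE)
  qed
  \<comment> \<open>The value of \<open>\<epsilon>\<close> is chosen to contradict \<open>L \<le> M * Re (H z0)\<close>: since
    \<open>r - norm z0 \<ge> (1 - norm z0) / 2\<close>, grid intervals of total length less than \<open>\<epsilon>\<close> give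
    \<open>Re (H z0) < 12 * \<epsilon> / (1 - norm z0)\<close>.\<close>
  define M where "M = ln (\<eta> / \<sigma>)"
  have M: "0 < M" "exp M = \<eta> / \<sigma>" using \<sigma>\<eta> assms(3) by (auto simp: M_def)
  define L where "L = ln (\<eta> / norm (f z0))"
  have "1 < \<eta> / norm (f z0)" using f0(2) by (simp only: less_divide_eq_1_pos[OF f0(1)])
  then have L: "0 < L" unfolding L_def by (rule ln_gt_zero)
  define \<epsilon> where "\<epsilon> = L * (1 - norm z0) / (12 * M)"
  have \<epsilon>: "0 < \<epsilon>" using L M z0b by (simp add: \<epsilon>_def)
  obtain r where r: "(1 + norm z0) / 2 < r" "0 < r" "r < 1"
    and K0: "compact {t\<in>{0..2*pi}. norm (f (of_real r * cis t)) \<le> \<eta>}"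
      "measure lebesgue {t\<in>{0..2*pi}. norm (f (of_real r * cis t)) \<le> \<eta>} < \<epsilon>"
  proof (rule inner_function_small_level_on_circle[OF f assms(2) \<epsilon>])
    show "(1 + norm z0) / 2 < 1" using z0b by simp
  qed
  define K where "K = {t\<in>{0..2*pi}. norm (f (of_real r * cis t)) \<le> \<eta>}"
  note K = K0[folded K_def]
  obtain \<delta> I where \<delta>: "0 < \<delta>" "\<delta> \<le> 1" and I: "finite (I :: nat set)" "real (card I) * \<delta> < \<epsilon>"
    and cover: "\<And>t. t \<in> K \<Longrightarrow> 0 \<le> t \<Longrightarrow> \<exists>k\<in>I. \<bar>t - real k * \<delta>\<bar> \<le> \<delta>"
    using compact_small_measure_grid_cover[OF K] by metis
  obtain H where H: "H holomorphic_on ball 0 ((1 + \<delta>) * r)"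
    "\<And>z. norm z \<le> r \<Longrightarrow> 0 \<le> Re (H z)"
    "\<And>t k. k \<in> I \<Longrightarrow> \<bar>t - real k * \<delta>\<bar> \<le> \<delta> \<Longrightarrow> 1 \<le> Re (H (of_real r * cis t))"
    "\<And>z. norm z < r \<Longrightarrow> Re (H z) \<le> 6 * r * (real (card I) * \<delta>) / (r - norm z)"
    by (rule small_potential_of_short_arcs[OF r(2) \<delta> I(1)]) (rule that; blast)
  define G where "G = C \<inter> ball 0 r"
  define F where "F = (\<lambda>z. of_real \<eta> / f z * exp (- of_real M * H z))"
  have nF: "norm (F z) = \<eta> / norm (f z) * exp (- M * Re (H z))" for z
    using \<sigma>\<eta> by (simp add: F_def norm_mult norm_divide norm_exp_eq_Re)
  have clG: "z \<in> closure C \<and> norm z \<le> r" if "z \<in> closure G" for z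
  proof -
    have "closure G \<subseteq> closure C" unfolding G_def by (intro closure_mono) auto
    moreover have "closure G \<subseteq> cball 0 r" unfolding G_def by (intro closure_minimal) auto
    ultimately show ?thesis using that by auto
  qed
  have rr: "r < (1 + \<delta>) * r" using r \<delta> by (simp add: algebra_simps)
  have holF: "F holomorphic_on G" unfolding F_def G_def
    using Cge assms(3) Cb rr
    by (intro holomorphic_intros holomorphic_on_subset[OF holf] holomorphic_on_subset[OF H(1)]) fastforce+
  have contF: "continuous_on (closure G) F" unfolding F_def
    using clG clC r(3) assms(3) rr
    by (intro continuous_intros continuous_on_subset[OF contf]
        continuous_on_subset[OF holomorphic_on_imp_continuous_on[OF H(1)]]) fastforce+
  have "norm (F z0) \<le> 1"
  proof (rule maximum_modulus_frontier[of F G])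
    have Gopen: "open G" using Copen by (auto simp: G_def)
    then show "F holomorphic_on interior G" using holF by (simp add: interior_open)
    show "continuous_on (closure G) F" by (rule contF)
    show "bounded G" unfolding G_def by (rule bounded_subset[of "ball 0 r"]) auto
    show "z0 \<in> G" using z0 r z0b by (simp add: G_def)
    fix z assume "z \<in> frontier G"
    then have z: "z \<in> closure C" "norm z \<le> r" "z \<notin> G"
      using clG Gopen by (auto simp: frontier_def interior_open)
    have nz: "norm z < 1" using z(2) r by simp
    have fz: "\<sigma> \<le> norm (f z)" using clC z(1) nz by blast
    \<comment> \<open>Points of the frontier where \<open>\<eta> \<le> norm (f z)\<close> fails must lie in \<open>C\<close>, hence on the cutting
      circle, in one of the exceptional arcs; there \<open>exp (- M * Re (H z))\<close> compensates for
      \<open>\<eta> / norm (f z)\<close>, which is at most \<open>\<eta> / \<sigma>\<close>.\<close>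
    show "norm (F z) \<le> 1"
    proof (cases "\<eta> \<le> norm (f z)")
      case True
      have "\<eta> / norm (f z) \<le> 1" using True \<sigma>\<eta>(2) by (subst divide_le_eq_1_pos) auto
      moreover have "exp (- M * Re (H z)) \<le> 1" using M H(2)[OF z(2)] by simp
      ultimately show ?thesis unfolding nF using \<sigma>\<eta> by (intro mult_le_one) auto
    next
      case False
      then have "z \<in> C" using bdC z(1) nz by blast
      then have nzr: "norm z = r" using z by (auto simp: G_def)
      obtain t where t: "z = of_real r * cis t" "0 \<le> t" "t < 2*pi"
        using Arg2pi[of z] nzr by (metis cis_conv_exp is_Arg_def)
      then obtain k where "k \<in> I" "\<bar>t - real k * \<delta>\<bar> \<le> \<delta>" using cover[of t] False by (auto simp: K_def)
      then have "1 \<le> Re (H z)" using H(3) t by blast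
      then have "exp (- M * Re (H z)) \<le> exp (- M)" using M by simp
      also have "\<dots> = \<sigma> / \<eta>" using M by (simp add: exp_minus)
      finally have "norm (F z) \<le> \<eta> / \<sigma> * (\<sigma> / \<eta>)"
        unfolding nF using fz \<sigma>\<eta> assms(3) by (intro mult_mono frac_le) auto
      then show ?thesis using \<sigma>\<eta> assms(3) by simp
    qed
  qed
  then have "exp L * exp (- M * Re (H z0)) \<le> 1" unfolding nF L_def using f0 \<sigma>\<eta> by simp
  then have "L \<le> M * Re (H z0)" by (simp flip: exp_add)
  also have "Re (H z0) \<le> 6 * r * (real (card I) * \<delta>) / (r - norm z0)"
    using r z0b by (intro H(4)) simp
  also have "\<dots> \<le> 6 * (real (card I) * \<delta>) / ((1 - norm z0) / 2)"
  proof (rule frac_le)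
    show "6 * r * (real (card I) * \<delta>) \<le> 6 * (real (card I) * \<delta>)"
      using r \<delta> mult_right_mono[of r 1 "real (card I) * \<delta>"] by simp
  qed (use r \<delta> z0b in \<open>auto simp: field_simps\<close>)
  also have "\<dots> < 6 * \<epsilon> / ((1 - norm z0) / 2)"
    using I z0b by (intro divide_strict_right_mono) auto
  also have "M * (6 * \<epsilon> / ((1 - norm z0) / 2)) = L" using M z0b by (simp add: \<epsilon>_def field_simps)
  finally show False using M by simp
qed

text \<open>
  Every component of the sublevel set meets \<open>S\<close>, by the preceding lemma, and the connected set \<open>S\<close>
  lies in a single component.
\<close>
lemma connected_sublevel_setI:
  assumes f: "inner_function f" and "\<eta> < 1" "0 < \<sigma>" and S: "connected S"
    and "sublevel_set f \<sigma> \<subseteq> S" "S \<subseteq> sublevel_set f \<eta>"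
  shows "connected (sublevel_set f \<eta>)"
proof -
  have meets: "connected_component_set (sublevel_set f \<eta>) z \<inter> S \<noteq> {}" if "z \<in> sublevel_set f \<eta>" for z
    using component_of_sublevel_set_meets_lower_sublevel_set[OF f assms(2,3), of "connected_component_set (sublevel_set f \<eta>) z"]
      that assms(5) by (auto simp: components_def)
  show ?thesis unfolding connected_iff_connected_component
  proof (intro ballI)
    fix x y assume "x \<in> sublevel_set f \<eta>" "y \<in> sublevel_set f \<eta>"
    then obtain a b where "a \<in> S" "b \<in> S" "connected_component (sublevel_set f \<eta>) x a"
      "connected_component (sublevel_set f \<eta>) y b"
      using meets[of x] meets[of y] by auto
    moreover have "connected_component (sublevel_set f \<eta>) a b"
      using S assms(6) \<open>a \<in> S\<close> \<open>b \<in> S\<close> unfolding connected_component_def by blast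
    ultimately show "connected_component (sublevel_set f \<eta>) x y"
      by (meson connected_component_sym connected_component_trans)
  qed
qed

section \<open>Composition with a finite Blaschke product\<close>

text \<open>
  The values of \<open>B\<close> outside the closed disk are arbitrary, so holomorphy on the closed disk, which
  refers to neighbourhoods only within that set, is stated for the defining formula \<open>b\<close> instead.
\<close>
lemma finite_Blaschke_product_properties:
  assumes "finite_Blaschke_product B"
  obtains b Z where "\<And>z. z \<in> cball 0 1 \<Longrightarrow> B z = b z" "b holomorphic_on cball 0 1"
    "\<And>z. norm z < 1 \<Longrightarrow> norm (b z) < 1" "\<And>z. norm z = 1 \<Longrightarrow> norm (b z) = 1"
    "finite Z" "Z \<subseteq> ball 0 1" "\<And>z. z \<in> cball 0 1 \<Longrightarrow> b z = 0 \<Longrightarrow> z \<in> Z"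
proof -
  obtain \<theta> :: real and N :: nat and a :: "nat \<Rightarrow> complex" where N: "N \<ge> 1"
    and a': "\<forall>j\<in>{1..N}. a j \<in> ball 0 1"
    and B: "\<forall>z\<in>cball 0 1.
      B z = exp (\<i> * of_real \<theta>) * (\<Prod>j=1..N. (a j - z) / (1 - cnj (a j) * z))"
    using assms unfolding finite_Blaschke_product_def by blast
  have a: "norm (a j) < 1" if "j \<in> {1..N}" for j using a' that by auto
  define b where "b = (\<lambda>z. exp (\<i> * of_real \<theta>) * (\<Prod>j=1..N. (a j - z) / (1 - cnj (a j) * z)))"
  have den: "1 - cnj (a j) * z \<noteq> 0" if "j \<in> {1..N}" "norm z \<le> 1" for j z
  proof
    assume "1 - cnj (a j) * z = 0"
    then have "norm (a j) * norm z = 1" by (metis complex_mod_cnj norm_mult norm_one right_minus_eq)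
    moreover have "norm (a j) * norm z \<le> norm (a j)" using that by (simp add: mult_left_le)
    ultimately show False using a[OF that(1)] by linarith
  qed
  have nb: "norm (b z) = (\<Prod>j=1..N. norm ((a j - z) / (1 - cnj (a j) * z)))" for z
    by (simp add: b_def norm_mult prod_norm)
  have "b holomorphic_on cball 0 1"
    unfolding b_def using den by (intro holomorphic_intros) auto
  moreover have "norm (b z) < 1" if "norm z < 1" for z
  proof -
    have factor: "norm ((a j - z) / (1 - cnj (a j) * z)) < 1" if "j \<in> {1..N}" for j
      using Moebius_function_norm_lt_1[OF a[OF that] \<open>norm z < 1\<close>, of 0]
      by (simp add: Moebius_function_simple norm_divide norm_minus_commute)
    moreover have "norm (b z) = norm ((a 1 - z) / (1 - cnj (a 1) * z)) *
        (\<Prod>j\<in>{1..N} - {1}. norm ((a j - z) / (1 - cnj (a j) * z)))"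
      unfolding nb using N by (intro prod.remove) auto
    moreover have "(\<Prod>j\<in>{1..N} - {1}. norm ((a j - z) / (1 - cnj (a j) * z))) \<le> 1"
      by (rule prod_le_1) (use factor in \<open>force intro: less_imp_le\<close>)
    ultimately have "norm (b z) \<le> norm ((a 1 - z) / (1 - cnj (a 1) * z))"
      by (simp only: mult_left_le norm_ge_zero)
    also have "\<dots> < 1" using factor N by simp
    finally show ?thesis .
  qed
  moreover have "norm (b z) = 1" if z: "norm z = 1" for z
  proof -
    have "norm ((a j - z) / (1 - cnj (a j) * z)) = 1" if j: "j \<in> {1..N}" for j
    proof -
      have "1 - cnj (a j) * z = z * cnj (z - a j)"
        using z by (simp add: algebra_simps complex_norm_square[symmetric])
      then have "norm (1 - cnj (a j) * z) = norm (a j - z)"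
        by (simp only: norm_mult complex_mod_cnj z norm_minus_commute mult_1)
      moreover have "norm (1 - cnj (a j) * z) \<noteq> 0" using den[OF j, of z] z by simp
      ultimately show ?thesis by (simp add: norm_divide)
    qed
    then show ?thesis by (simp add: nb)
  qed
  moreover have "z \<in> a ` {1..N}" if "z \<in> cball 0 1" "b z = 0" for z
    using that den[of _ z] by (auto simp: b_def)
  moreover have "a ` {1..N} \<subseteq> ball 0 1" using a by auto
  ultimately show thesis
    using that[of b "a ` {1..N}"] B by (simp add: b_def)
qed

text \<open>
  Continuity of \<open>B\<close> up to the unit circle, where it is unimodular, carries the radial limits of \<open>u\<close>
  over to the composition. A unimodular constant \<open>u\<close>, whose values lie on the unit circle, is
  included because \<open>B\<close> is holomorphic up to the circle as well.
\<close>
lemma inner_function_compose_Blaschke: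
  assumes B: "finite_Blaschke_product B" and u: "inner_function u"
  shows "inner_function (B \<circ> u)"
proof -
  obtain b where b: "\<And>z. z \<in> cball 0 1 \<Longrightarrow> B z = b z" "b holomorphic_on cball 0 1"
    "\<And>z. norm z < 1 \<Longrightarrow> norm (b z) < 1" "\<And>z. norm z = 1 \<Longrightarrow> norm (b z) = 1"
    using finite_Blaschke_product_properties[OF B] by metis
  have uh: "u holomorphic_on ball 0 1" and ub: "\<And>z. z \<in> ball 0 1 \<Longrightarrow> u z \<in> cball 0 1"
    and ur: "AE t in lebesgue_on {0..2*pi}. \<exists>l. has_radial_limit u t l \<and> norm l = 1"
    using u by (auto simp: inner_function_def)
  have eq: "(B \<circ> u) z = (b \<circ> u) z" if "z \<in> ball 0 1" for z
    using b(1)[OF ub[OF that]] by simp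
  have bound: "norm (b z) \<le> 1" if "z \<in> cball 0 1" for z
    using b(3,4)[of z] that by (cases "norm z < 1") auto
  have "b \<circ> u holomorphic_on ball 0 1"
    using ub by (intro holomorphic_on_compose_gen[OF uh b(2)]) auto
  then have "B \<circ> u holomorphic_on ball 0 1"
    by (rule holomorphic_transform) (use eq in \<open>metis\<close>)
  moreover have "norm ((B \<circ> u) z) \<le> 1" if "z \<in> ball 0 1" for z
    using eq[OF that] bound[OF ub[OF that]] by simp
  moreover have radial: "\<exists>l. has_radial_limit (B \<circ> u) t l \<and> norm l = 1"
    if "has_radial_limit u t l" "norm l = 1" for t l
  proof -
    have "\<forall>\<^sub>F r in at_left 1. (0::real) < r" "\<forall>\<^sub>F r in at_left 1. r < (1::real)"
      by (auto simp: eventually_at_left_field intro: exI[of _ 0])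
    then have ev: "\<forall>\<^sub>F r in at_left 1. of_real r * cis t \<in> ball 0 1"
      by eventually_elim (simp add: norm_mult)
    have "continuous_on (cball 0 1) b" using b(2) by (rule holomorphic_on_imp_continuous_on)
    then have "((\<lambda>r. b (u (of_real r * cis t))) \<longlongrightarrow> b l) (at_left 1)"
      using that ub by (elim continuous_on_tendsto_compose)
        (auto simp: has_radial_limit_def intro!: eventually_mono[OF ev])
    then have "((\<lambda>r. (B \<circ> u) (of_real r * cis t)) \<longlongrightarrow> b l) (at_left 1)"
      by (rule Lim_transform_eventually) (use ev eq in \<open>auto elim!: eventually_mono\<close>)
    then show ?thesis using b(4)[OF that(2)] by (auto simp: has_radial_limit_def)
  qed
  have "AE t in lebesgue_on {0..2*pi}. \<exists>l. has_radial_limit (B \<circ> u) t l \<and> norm l = 1"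
    using ur by eventually_elim (use radial in blast)
  ultimately show ?thesis by (auto simp: inner_function_def)
qed

theorem corollary2p17:
  fixes B \<Theta> :: "complex \<Rightarrow> complex"
  assumes "finite_Blaschke_product B"
    and "\<Theta> \<in> one_component_inner"
  shows "B \<circ> \<Theta> \<in> one_component_inner"
proof -
  obtain \<eta> where \<Theta>: "inner_function \<Theta>" and \<eta>: "0 < \<eta>" "\<eta> < 1" "connected (sublevel_set \<Theta> \<eta>)"
    using assms(2) by (auto simp: one_component_inner_def)
  have \<Theta>b: "norm (\<Theta> z) \<le> 1" if "z \<in> ball 0 1" for z using \<Theta> that by (simp add: inner_function_def)
  obtain b Z where b: "\<And>z. z \<in> cball 0 1 \<Longrightarrow> B z = b z" "b holomorphic_on cball 0 1"
    "\<And>z. norm z < 1 \<Longrightarrow> norm (b z) < 1"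
    and Z: "finite Z" "Z \<subseteq> ball 0 1" "\<And>z. z \<in> cball 0 1 \<Longrightarrow> b z = 0 \<Longrightarrow> z \<in> Z"
    using finite_Blaschke_product_properties[OF assms(1)] by metis
  have cb: "continuous_on (cball 0 1) (\<lambda>z. norm (b z))"
    using b(2) by (intro continuous_intros holomorphic_on_imp_continuous_on)
  define \<rho> where "\<rho> = Max (insert \<eta> (norm ` Z))"
  have \<rho>1: "\<rho> < 1" and \<rho>\<eta>: "\<eta> \<le> \<rho>" and \<rho>Z: "\<And>z. z \<in> Z \<Longrightarrow> norm z \<le> \<rho>"
    using Z \<eta> by (auto simp: \<rho>_def)
  define \<eta>1 where "\<eta>1 = (1 + \<rho>) / 2"
  have \<eta>1: "0 < \<eta>1" "\<eta>1 < 1" "\<rho> < \<eta>1" using \<rho>1 \<rho>\<eta> \<eta> by (auto simp: \<eta>1_def)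
  have conn1: "connected (sublevel_set \<Theta> \<eta>1)"
    using \<rho>\<eta> \<eta>1 by (intro connected_sublevel_setI[OF \<Theta> \<eta>1(2) \<eta>(1,3)]) (auto simp: sublevel_set_def)
  obtain m where m: "norm m \<le> \<eta>1" "\<And>w. norm w \<le> \<eta>1 \<Longrightarrow> norm (b w) \<le> norm (b m)"
    using continuous_attains_sup[of "cball 0 \<eta>1" "\<lambda>z. norm (b z)"] \<eta>1 continuous_on_subset[OF cb, of "cball 0 \<eta>1"]
    by fastforce
  define \<eta>2 where "\<eta>2 = (1 + norm (b m)) / 2"
  have \<eta>2: "0 < \<eta>2" "\<eta>2 < 1" "norm (b m) < \<eta>2"
    using b(3)[of m] m(1) \<eta>1 by (auto simp: \<eta>2_def add_pos_nonneg)
  \<comment> \<open>All zeros of \<open>b\<close> have modulus less than \<open>\<eta>1\<close>, so \<open>norm (b w)\<close> has a positive minimum on \<open>R\<close>.\<close>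
  define R where "R = cball (0::complex) 1 - ball 0 \<eta>1"
  have "compact R" unfolding R_def by (intro compact_diff) auto
  moreover have "1 \<in> R" using \<eta>1 by (auto simp: R_def)
  moreover have "continuous_on R (\<lambda>z. norm (b z))" using cb by (rule continuous_on_subset) (auto simp: R_def)
  ultimately obtain q where q: "q \<in> R" "\<And>w. w \<in> R \<Longrightarrow> norm (b q) \<le> norm (b w)"
    using continuous_attains_inf[of R "\<lambda>z. norm (b z)"] by blast
  have q0: "0 < norm (b q)" using q(1) Z(3)[of q] \<rho>Z[of q] \<eta>1 by (auto simp: R_def)
  have "inner_function (B \<circ> \<Theta>)" using assms(1) \<Theta> by (rule inner_function_compose_Blaschke)
  moreover have "connected (sublevel_set (B \<circ> \<Theta>) \<eta>2)"
  proof (rule connected_sublevel_setI[OF calculation \<eta>2(2) q0 conn1])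
    show "sublevel_set (B \<circ> \<Theta>) (norm (b q)) \<subseteq> sublevel_set \<Theta> \<eta>1"
    proof
      fix z assume z: "z \<in> sublevel_set (B \<circ> \<Theta>) (norm (b q))"
      then have zb: "z \<in> ball 0 1" "\<Theta> z \<in> cball 0 1" using \<Theta>b by (auto simp: sublevel_set_def)
      then have "norm (b (\<Theta> z)) < norm (b q)" using z b(1) by (auto simp: sublevel_set_def)
      then have "\<Theta> z \<notin> R" using q(2)[of "\<Theta> z"] by auto
      then show "z \<in> sublevel_set \<Theta> \<eta>1" using zb by (auto simp: R_def sublevel_set_def)
    qed
    show "sublevel_set \<Theta> \<eta>1 \<subseteq> sublevel_set (B \<circ> \<Theta>) \<eta>2"
    proof
      fix z assume "z \<in> sublevel_set \<Theta> \<eta>1"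
      then have z: "z \<in> ball 0 1" "norm (\<Theta> z) \<le> \<eta>1" by (auto simp: sublevel_set_def)
      then show "z \<in> sublevel_set (B \<circ> \<Theta>) \<eta>2"
        using m(2)[OF z(2)] \<eta>2(3) b(1)[of "\<Theta> z"] \<Theta>b[OF z(1)] by (simp add: sublevel_set_def)
    qed
  qed
  ultimately show ?thesis using \<eta>2 by (auto simp: one_component_inner_def)
qed

end
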